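(* Let $W$, $X$, $Y$ and $Z$ be Riesz spaces with $X$, $Y$ and $Z$ Dedekind complete. Let $0\leq A_0\in L^{r}_{n}(Y, Z)$. Then for all $B, D\in L^{r}(W, X)$ and all $T\in L^{r}_{n}(X, Y)$ we have $$|M_{A_0, B}|(T)=M_{A_0, |B|}(T)$$ and, equivalently, $$(M_{A_0, B}\vee M_{A_0, D})(T)=M_{A_0, B\vee D}(T).$$
   Context: Riesz spaces are real vector lattices. For a Riesz space $E$ and a Dedekind complete Riesz space $F$, $L^{r}(E,F)$ denotes the set of all regular operators from $E$ into $F$ (differences of two positive linear operators); ordered by $S\le T$ iff $T-S$ is positive, it is a Dedekind complete Riesz space. $L^{r}_{n}(E,F)$ denotes the set of all order continuous operators in $L^{r}(E,F)$. For $A\in L^{r}(Y,Z)$ and $B\in L^{r}(W,X)$, the two-sided multiplication operator $M_{A,B}: L^{r}(X,Y)\to L^{r}(W,Z)$ is defined by $M_{A,B}(T)=ATB$. It is a regular operator, and its modulus $|M_{A,B}|$ and the suprema $M_{A,B}\vee M_{C,D}$ are taken in the Dedekind complete Riesz space $L^{r}\big(L^{r}(X, Y), L^{r}(W, Z)\big)$. The modulus $|B|$ and the supremum $B\vee D$ are taken in $L^{r}(W,X)$. *)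

theory Defs
  imports "HOL-Analysis.Analysis" "HOL-Library.Lattice_Algebras"
begin

class riesz_space = ordered_real_vector + lattice_ab_group_add_abs

text \<open>Only suprema of nonempty bounded above sets (and dually infima) are constrained; the values
  of \<open>Sup\<close> and \<open>Inf\<close> on all other sets carry no meaning.\<close>

class dedekind_complete_riesz_space = riesz_space + conditionally_complete_lattice

instance real :: dedekind_complete_riesz_space
  by standard (simp add: sup_real_def abs_real_def)

lemma riesz_decomposition:
  fixes a b c d :: "'a::riesz_space"
  assumes "0 \<le> a" "0 \<le> b" "0 \<le> c" "0 \<le> d" "a + b = c + d"
  obtains p q r s where "0 \<le> p" "0 \<le> q" "0 \<le> r" "0 \<le> s"
    "a = p + q" "b = r + s" "c = p + r" "d = q + s"
proof
  let ?p = "inf a c"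
  show "0 \<le> ?p" using assms by simp
  show "0 \<le> a - ?p" "0 \<le> c - ?p" by (simp_all only: diff_ge_0_iff_ge inf_le1 inf_le2)
  have "c \<le> a + b" using assms(4) by (simp add: assms(5))
  then have "a + c - (a + b) \<le> ?p"
    using assms(1,2) by (intro inf_greatest) (simp_all add: algebra_simps)
  moreover have "0 \<le> b - (c - q)" if "a + c - (a + b) \<le> q" for q
    using that by (simp add: algebra_simps)
  ultimately show "0 \<le> b - (c - ?p)" by blast
  show "d = (a - ?p) + (b - (c - ?p))"
    using assms(5) by (simp add: algebra_simps)
qed (simp_all only: add_diff_eq add_diff_cancel_left')

lemma riesz_minus_eq_pos_parts:
  fixes x :: "'a::riesz_space"
  shows "x = sup x 0 - sup (- x) 0"
  using prts[of x] pprt_neg[of x] by (simp add: pprt_def)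


section \<open>Regular operators\<close>

definition positive_operator :: "('a::riesz_space \<Rightarrow> 'b::riesz_space) \<Rightarrow> bool" where
  "positive_operator T \<longleftrightarrow> linear T \<and> (\<forall>x. 0 \<le> x \<longrightarrow> 0 \<le> T x)"

definition regular :: "('a::riesz_space \<Rightarrow> 'b::riesz_space) \<Rightarrow> bool" where
  "regular T \<longleftrightarrow> (\<exists>P Q. positive_operator P \<and> positive_operator Q \<and> T = (\<lambda>x. P x - Q x))"

lemma positive_operator_linear: "positive_operator T \<Longrightarrow> linear T"
  by (simp add: positive_operator_def)

lemma positive_operator_zero: "positive_operator (\<lambda>x. 0)"
  by (simp add: positive_operator_def linear_zero)

lemma positive_operator_add:
  "positive_operator S \<Longrightarrow> positive_operator T \<Longrightarrow> positive_operator (\<lambda>x. S x + T x)"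
  by (simp add: positive_operator_def linear_compose_add)

lemma positive_operator_scaleR:
  "0 \<le> r \<Longrightarrow> positive_operator T \<Longrightarrow> positive_operator (\<lambda>x. r *\<^sub>R T x)"
  by (simp add: positive_operator_def linear_compose_scale_right scaleR_nonneg_nonneg)

lemma positive_operator_comp:
  "positive_operator S \<Longrightarrow> positive_operator T \<Longrightarrow> positive_operator (\<lambda>x. S (T x))"
  using linear_compose[of T S] by (simp add: positive_operator_def o_def)

lemma regular_linear: "regular T \<Longrightarrow> linear T"
  by (auto simp: regular_def intro: linear_compose_sub positive_operator_linear)

lemma regularI:
  "positive_operator P \<Longrightarrow> positive_operator Q \<Longrightarrow> (\<And>x. T x = P x - Q x) \<Longrightarrow> regular T"
  by (auto simp: regular_def)

lemma regular_zero: "regular (\<lambda>x. 0)"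
  by (rule regularI[OF positive_operator_zero positive_operator_zero]) simp

lemma regular_uminus: "regular T \<Longrightarrow> regular (\<lambda>x. - T x)"
  unfolding regular_def by (metis minus_diff_eq)

lemma regular_add:
  assumes "regular S" "regular T" shows "regular (\<lambda>x. S x + T x)"
proof -
  from assms obtain P Q P' Q' where
    "positive_operator P" "positive_operator Q" "S = (\<lambda>x. P x - Q x)"
    "positive_operator P'" "positive_operator Q'" "T = (\<lambda>x. P' x - Q' x)"
    unfolding regular_def by blast
  then show ?thesis
    by (intro regularI[of "\<lambda>x. P x + P' x" "\<lambda>x. Q x + Q' x"] positive_operator_add) auto
qed

lemma regular_diff: "regular S \<Longrightarrow> regular T \<Longrightarrow> regular (\<lambda>x. S x - T x)"
  using regular_add[of S "\<lambda>x. - T x"] regular_uminus[of T] by simp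

lemma regular_scaleR:
  assumes "regular T" shows "regular (\<lambda>x. r *\<^sub>R T x)"
proof -
  from assms obtain P Q where PQ: "positive_operator P" "positive_operator Q" "T = (\<lambda>x. P x - Q x)"
    unfolding regular_def by blast
  show ?thesis
  proof (cases "0 \<le> r")
    case True
    with PQ show ?thesis
      by (intro regularI[of "\<lambda>x. r *\<^sub>R P x" "\<lambda>x. r *\<^sub>R Q x"] positive_operator_scaleR)
        (auto simp: scaleR_diff_right)
  next
    case False
    with PQ show ?thesis
      by (intro regularI[of "\<lambda>x. (- r) *\<^sub>R Q x" "\<lambda>x. (- r) *\<^sub>R P x"] positive_operator_scaleR)
        (auto simp: scaleR_diff_right)
  qed
qed

lemma regular_comp:
  assumes "regular S" "regular T" shows "regular (\<lambda>x. S (T x))"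
proof -
  from assms obtain P Q P' Q' where *:
    "positive_operator P" "positive_operator Q" "S = (\<lambda>x. P x - Q x)"
    "positive_operator P'" "positive_operator Q'" "T = (\<lambda>x. P' x - Q' x)"
    unfolding regular_def by blast
  then have lin: "linear P" "linear Q" by (simp_all add: positive_operator_linear)
  show ?thesis
  proof (rule regularI)
    show "positive_operator (\<lambda>x. P (P' x) + Q (Q' x))" "positive_operator (\<lambda>x. P (Q' x) + Q (P' x))"
      by (rule positive_operator_add; rule positive_operator_comp; fact *)+
    show "S (T x) = (P (P' x) + Q (Q' x)) - (P (Q' x) + Q (P' x))" for x
      by (simp add: *(3,6) linear_diff[OF lin(1)] linear_diff[OF lin(2)])
  qed
qed

typedef (overloaded) ('a::riesz_space, 'b::riesz_space) regular_operator =
  "{T :: 'a \<Rightarrow> 'b. regular T}" morphisms op_app Abs_regular_operator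
  by (auto intro: regular_zero)

setup_lifting type_definition_regular_operator

lemma regular_op_app: "regular (op_app T)"
  using op_app[of T] by simp

lemma linear_op_app: "linear (op_app T)"
  by (rule regular_linear[OF regular_op_app])

lemmas op_app_linear_simps =
  linear_0[OF linear_op_app] linear_add[OF linear_op_app] linear_diff[OF linear_op_app]
  linear_neg[OF linear_op_app] linear_scale[OF linear_op_app]

instantiation regular_operator :: (riesz_space, riesz_space) real_vector
begin

lift_definition zero_regular_operator :: "('a, 'b) regular_operator" is "\<lambda>x. 0"
  by (rule regular_zero)
lift_definition plus_regular_operator ::
  "('a, 'b) regular_operator \<Rightarrow> ('a, 'b) regular_operator \<Rightarrow> ('a, 'b) regular_operator"
  is "\<lambda>S T x. S x + T x" by (rule regular_add)
lift_definition minus_regular_operator ::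
  "('a, 'b) regular_operator \<Rightarrow> ('a, 'b) regular_operator \<Rightarrow> ('a, 'b) regular_operator"
  is "\<lambda>S T x. S x - T x" by (rule regular_diff)
lift_definition uminus_regular_operator ::
  "('a, 'b) regular_operator \<Rightarrow> ('a, 'b) regular_operator"
  is "\<lambda>T x. - T x" by (rule regular_uminus)
lift_definition scaleR_regular_operator ::
  "real \<Rightarrow> ('a, 'b) regular_operator \<Rightarrow> ('a, 'b) regular_operator"
  is "\<lambda>r T x. r *\<^sub>R T x" by (rule regular_scaleR)

instance
  by standard (transfer; simp add: algebra_simps)+

end

lemmas op_app_simps =
  zero_regular_operator.rep_eq plus_regular_operator.rep_eq minus_regular_operator.rep_eq
  uminus_regular_operator.rep_eq scaleR_regular_operator.rep_eq

lemma op_app_eqI: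
  fixes S T :: "('a::riesz_space, 'b::riesz_space) regular_operator"
  assumes "\<And>x. 0 \<le> x \<Longrightarrow> op_app S x = op_app T x"
  shows "S = T"
proof -
  have "op_app S x = op_app T x" for x
    using riesz_minus_eq_pos_parts[of x] assms[of "sup x 0"] assms[of "sup (- x) 0"]
    by (metis linear_diff[OF linear_op_app] sup_ge2)
  then show ?thesis by (intro op_app_inject[THEN iffD1] ext)
qed

instantiation regular_operator :: (riesz_space, riesz_space) ordered_real_vector
begin

definition less_eq_regular_operator ::
  "('a, 'b) regular_operator \<Rightarrow> ('a, 'b) regular_operator \<Rightarrow> bool" where
  "S \<le> T \<longleftrightarrow> positive_operator (op_app (T - S))"

definition less_regular_operator ::
  "('a, 'b) regular_operator \<Rightarrow> ('a, 'b) regular_operator \<Rightarrow> bool" where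
  "S < T \<longleftrightarrow> S \<le> T \<and> \<not> T \<le> (S :: ('a, 'b) regular_operator)"

lemma regular_operator_le_iff:
  fixes S T :: "('a, 'b) regular_operator"
  shows "S \<le> T \<longleftrightarrow> (\<forall>x. 0 \<le> x \<longrightarrow> op_app S x \<le> op_app T x)"
  by (simp add: less_eq_regular_operator_def positive_operator_def linear_op_app)
    (simp add: op_app_simps)

instance
proof
  fix S T U :: "('a, 'b) regular_operator" and a b :: real
  show "S < T \<longleftrightarrow> S \<le> T \<and> \<not> T \<le> S" by (rule less_regular_operator_def)
  show "S \<le> S" by (simp add: regular_operator_le_iff)
  show "S \<le> T \<Longrightarrow> T \<le> U \<Longrightarrow> S \<le> U" unfolding regular_operator_le_iff by (meson order_trans)
  show "S \<le> T \<Longrightarrow> T \<le> S \<Longrightarrow> S = T"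
    unfolding regular_operator_le_iff by (intro op_app_eqI order_antisym) auto
  show "S \<le> T \<Longrightarrow> U + S \<le> U + T" by (simp add: regular_operator_le_iff op_app_simps)
  show "S \<le> T \<Longrightarrow> 0 \<le> a \<Longrightarrow> a *\<^sub>R S \<le> a *\<^sub>R T"
    by (simp add: regular_operator_le_iff op_app_simps scaleR_left_mono)
  show "a \<le> b \<Longrightarrow> 0 \<le> S \<Longrightarrow> a *\<^sub>R S \<le> b *\<^sub>R S"
    by (simp add: regular_operator_le_iff op_app_simps scaleR_right_mono)
qed

end

lemma regular_operator_pos_decomp:
  fixes S :: "('a::riesz_space, 'b::riesz_space) regular_operator"
  obtains P Q where "0 \<le> P" "0 \<le> Q" "S = P - Q"
proof -
  from regular_op_app[of S] obtain P Q where
    PQ: "positive_operator P" "positive_operator Q" "op_app S = (\<lambda>x. P x - Q x)"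
    unfolding regular_def by blast
  have "regular P" "regular Q"
    using PQ(1,2) by (auto intro: regularI[OF _ positive_operator_zero])
  then have app: "op_app (Abs_regular_operator P) = P" "op_app (Abs_regular_operator Q) = Q"
    by (simp_all add: Abs_regular_operator_inverse)
  show ?thesis
  proof
    show "0 \<le> Abs_regular_operator P" "0 \<le> Abs_regular_operator Q"
      using PQ(1,2) by (auto simp: regular_operator_le_iff op_app_simps positive_operator_def app)
    show "S = Abs_regular_operator P - Abs_regular_operator Q"
      by (rule op_app_eqI) (simp add: op_app_simps app PQ(3))
  qed
qed

lemma regular_operator_pair_bounded:
  fixes S T :: "('a::riesz_space, 'b::riesz_space) regular_operator"
  shows "\<exists>R. S \<le> R \<and> T \<le> R"
proof -
  obtain P Q where S: "0 \<le> P" "0 \<le> Q" "S = P - Q" by (rule regular_operator_pos_decomp)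
  obtain P' Q' where T: "0 \<le> P'" "0 \<le> Q'" "T = P' - Q'" by (rule regular_operator_pos_decomp)
  have "P - Q \<le> P + P'" "P' - Q' \<le> P + P'"
    using S(1,2) T(1,2) by (simp_all add: diff_le_eq add_increasing add_increasing2)
  with S(3) T(3) show ?thesis by blast
qed


section \<open>The Riesz--Kantorovich theorem\<close>

text \<open>\<open>rk_sum \<A> x v\<close> means that \<open>v = S\<^sub>1 x\<^sub>1 + \<dots> + S\<^sub>n x\<^sub>n\<close> for some \<open>S\<^sub>i \<in> \<A>\<close> and some
  \<open>x\<^sub>i \<ge> 0\<close> with \<open>x = x\<^sub>1 + \<dots> + x\<^sub>n\<close>.\<close>

inductive rk_sum ::
  "('a::riesz_space, 'b::riesz_space) regular_operator set \<Rightarrow> 'a \<Rightarrow> 'b \<Rightarrow> bool"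
  for \<A> where
  single: "S \<in> \<A> \<Longrightarrow> 0 \<le> x \<Longrightarrow> rk_sum \<A> x (op_app S x)"
| plus: "rk_sum \<A> x v \<Longrightarrow> rk_sum \<A> y w \<Longrightarrow> rk_sum \<A> (x + y) (v + w)"

lemma rk_sum_nonneg: "rk_sum \<A> x v \<Longrightarrow> 0 \<le> x"
  by (induction rule: rk_sum.induct) simp_all

lemma rk_sum_le:
  assumes "\<And>S. S \<in> \<A> \<Longrightarrow> S \<le> R" and "rk_sum \<A> x v"
  shows "v \<le> op_app R x"
  using assms(2)
proof (induction rule: rk_sum.induct)
  case (single S x)
  with assms(1)[of S] show ?case by (simp add: regular_operator_le_iff)
next
  case (plus x v y w)
  then show ?case by (simp add: op_app_linear_simps add_mono)
qed

lemma rk_sum_scaleR: "rk_sum \<A> x v \<Longrightarrow> 0 \<le> r \<Longrightarrow> rk_sum \<A> (r *\<^sub>R x) (r *\<^sub>R v)"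
proof (induction rule: rk_sum.induct)
  case (single S x)
  then show ?case
    using rk_sum.single[of S \<A> "r *\<^sub>R x"]
    by (simp add: op_app_linear_simps scaleR_nonneg_nonneg)
next
  case (plus x v y w)
  then show ?case by (simp add: scaleR_add_right rk_sum.plus)
qed

lemma rk_sum_split:
  assumes "rk_sum \<A> z u" "z = a + b" "0 \<le> a" "0 \<le> b"
  shows "\<exists>v w. rk_sum \<A> a v \<and> rk_sum \<A> b w \<and> u = v + w"
  using assms
proof (induction arbitrary: a b rule: rk_sum.induct)
  case (single S x)
  then show ?case
    using rk_sum.single[of S \<A> a] rk_sum.single[of S \<A> b]
    by (auto simp: op_app_linear_simps)
next
  case (plus x v y w)
  have "0 \<le> x" "0 \<le> y" using plus.hyps by (auto dest: rk_sum_nonneg)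
  obtain p q r s where *: "0 \<le> p" "0 \<le> q" "0 \<le> r" "0 \<le> s"
    "x = p + q" "y = r + s" "a = p + r" "b = q + s"
    by (rule riesz_decomposition[OF \<open>0 \<le> x\<close> \<open>0 \<le> y\<close> plus.prems(2,3,1)])
  from plus.IH(1)[OF *(5,1,2)] obtain v1 v2 where
    1: "rk_sum \<A> p v1" "rk_sum \<A> q v2" "v = v1 + v2" by blast
  from plus.IH(2)[OF *(6,3,4)] obtain w1 w2 where
    2: "rk_sum \<A> r w1" "rk_sum \<A> s w2" "w = w1 + w2" by blast
  have "rk_sum \<A> a (v1 + w1)" "rk_sum \<A> b (v2 + w2)"
    using * 1 2 by (auto intro: rk_sum.plus)
  moreover have "v + w = (v1 + w1) + (v2 + w2)" using 1 2 by (simp add: algebra_simps)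
  ultimately show ?case by blast
qed

text \<open>A map that is additive and positively homogeneous on the positive cone extends linearly.\<close>

lemma linear_extension:
  fixes U :: "'a::riesz_space \<Rightarrow> 'b::riesz_space"
  assumes add: "\<And>x y. 0 \<le> x \<Longrightarrow> 0 \<le> y \<Longrightarrow> U (x + y) = U x + U y"
    and scale: "\<And>r x. 0 \<le> r \<Longrightarrow> 0 \<le> x \<Longrightarrow> U (r *\<^sub>R x) = r *\<^sub>R U x"
  obtains L where "linear L" "\<And>x. 0 \<le> x \<Longrightarrow> L x = U x"
proof
  let ?L = "\<lambda>x. U (sup x 0) - U (sup (- x) 0)"
  have key: "?L (x - y) = U x - U y" if "0 \<le> x" "0 \<le> y" for x y
  proof -
    let ?p = "sup (x - y) 0" and ?n = "sup (- (x - y)) 0"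
    have "x + n = p + y" if "x - y = p - n" for p n using that by (simp add: algebra_simps)
    from this[OF riesz_minus_eq_pos_parts] have "x + ?n = ?p + y" .
    then have "U x + U ?n = U ?p + U y"
      using that add[of x ?n] add[of ?p y] by simp
    then show ?thesis by (simp add: algebra_simps)
  qed
  have U0: "U 0 = 0" using scale[of 0 0] by simp
  show "?L x = U x" if "0 \<le> x" for x
    using key[of x 0] that U0 by simp
  show "linear ?L"
  proof (rule linearI)
    fix x y :: 'a
    let ?x = "sup x 0" and ?x' = "sup (- x) 0" and ?y = "sup y 0" and ?y' = "sup (- y) 0"
    have "x + y = (p + q) - (p' + q')" if "x = p - p'" "y = q - q'" for p q p' q'
      using that by (simp add: algebra_simps)
    from this[OF riesz_minus_eq_pos_parts riesz_minus_eq_pos_parts]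
    have "x + y = (?x + ?y) - (?x' + ?y')" .
    then have "?L (x + y) = ?L ((?x + ?y) - (?x' + ?y'))" by simp
    also have "\<dots> = U (?x + ?y) - U (?x' + ?y')" by (rule key) simp_all
    also have "\<dots> = ?L x + ?L y" by (simp add: add)
    finally show "?L (x + y) = ?L x + ?L y" .
  next
    fix r :: real and x :: 'a
    let ?x = "sup x 0" and ?x' = "sup (- x) 0"
    show "?L (r *\<^sub>R x) = r *\<^sub>R ?L x"
    proof (cases "0 \<le> r")
      case True
      have "r *\<^sub>R x = r *\<^sub>R ?x - r *\<^sub>R ?x'"
        using riesz_minus_eq_pos_parts[of x] by (metis scaleR_diff_right)
      then have "?L (r *\<^sub>R x) = ?L (r *\<^sub>R ?x - r *\<^sub>R ?x')" by simp
      also have "\<dots> = U (r *\<^sub>R ?x) - U (r *\<^sub>R ?x')"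
        using True by (intro key) (simp_all add: scaleR_nonneg_nonneg)
      also have "\<dots> = r *\<^sub>R ?L x" using True by (simp add: scale scaleR_diff_right)
      finally show ?thesis .
    next
      case False
      have "r *\<^sub>R x = (- r) *\<^sub>R ?x' - (- r) *\<^sub>R ?x"
        using riesz_minus_eq_pos_parts[of x]
        by (metis minus_diff_eq scaleR_diff_right scaleR_minus_left)
      then have "?L (r *\<^sub>R x) = ?L ((- r) *\<^sub>R ?x' - (- r) *\<^sub>R ?x)" by simp
      also have "\<dots> = U ((- r) *\<^sub>R ?x') - U ((- r) *\<^sub>R ?x)"
        using False by (intro key) (simp_all add: scaleR_nonneg_nonneg del: scaleR_minus_left)
      also have "\<dots> = (- r) *\<^sub>R U ?x' - (- r) *\<^sub>R U ?x"
        using False scale[of "- r"] by (simp del: scaleR_minus_left)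
      also have "\<dots> = r *\<^sub>R ?L x" by (simp add: scaleR_diff_right)
      finally show ?thesis .
    qed
  qed
qed

lemma regular_operator_ex_lub:
  fixes \<A> :: "('a::riesz_space, 'b::dedekind_complete_riesz_space) regular_operator set"
  assumes "\<A> \<noteq> {}" and bdd: "\<And>S. S \<in> \<A> \<Longrightarrow> S \<le> R"
  shows "\<exists>U. (\<forall>S\<in>\<A>. S \<le> U) \<and> (\<forall>R. (\<forall>S\<in>\<A>. S \<le> R) \<longrightarrow> U \<le> R)"
proof -
  from assms obtain S0 where S0: "S0 \<in> \<A>" by blast
  define P where "P x = {v. rk_sum \<A> x v}" for x
  define U where "U x = Sup (P x)" for x
  have ne: "P x \<noteq> {}" if "0 \<le> x" for x
    using rk_sum.single[OF S0 that] by (auto simp: P_def)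
  have bd: "bdd_above (P x)" for x
    using rk_sum_le[OF bdd] by (auto simp: P_def intro!: bdd_aboveI)
  have up: "v \<le> U x" if "rk_sum \<A> x v" for x v
    using that bd by (auto simp: U_def P_def intro: cSup_upper)
  have least: "U x \<le> u" if "0 \<le> x" "\<And>v. rk_sum \<A> x v \<Longrightarrow> v \<le> u" for x u
    unfolding U_def by (rule cSup_least[OF ne[OF that(1)]]) (simp add: P_def that(2))
  have add: "U (x + y) = U x + U y" if x: "0 \<le> x" and y: "0 \<le> y" for x y
  proof (rule order_antisym)
    show "U (x + y) \<le> U x + U y"
    proof (rule least)
      fix u assume "rk_sum \<A> (x + y) u"
      from rk_sum_split[OF this refl x y] show "u \<le> U x + U y" by (auto intro: add_mono up)
    qed (use x y in simp)
    have "U x \<le> U (x + y) - w" if w: "rk_sum \<A> y w" for w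
    proof (rule least[OF x])
      fix v assume "rk_sum \<A> x v"
      from up[OF rk_sum.plus[OF this w]] show "v \<le> U (x + y) - w" by (simp add: algebra_simps)
    qed
    then have "U y \<le> U (x + y) - U x" by (intro least y) (simp add: algebra_simps)
    then show "U x + U y \<le> U (x + y)" by (simp add: algebra_simps)
  qed
  have sc_le: "U (r *\<^sub>R x) \<le> r *\<^sub>R U x" if r: "0 < r" and x: "0 \<le> x" for r x
  proof (rule least)
    fix v assume "rk_sum \<A> (r *\<^sub>R x) v"
    from rk_sum_scaleR[OF this, of "inverse r"] r have "rk_sum \<A> x (inverse r *\<^sub>R v)" by simp
    from scaleR_left_mono[OF up[OF this], of r] r show "v \<le> r *\<^sub>R U x" by simp
  qed (use r x in \<open>simp add: scaleR_nonneg_nonneg\<close>)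
  have scale: "U (r *\<^sub>R x) = r *\<^sub>R U x" if r: "0 \<le> r" and x: "0 \<le> x" for r x
  proof (cases "r = 0")
    case True
    have "U 0 = 0" using add[of 0 0] by simp
    with True show ?thesis by simp
  next
    case False
    with r have r: "0 < r" by simp
    have "U x \<le> inverse r *\<^sub>R U (r *\<^sub>R x)"
      using sc_le[of "inverse r" "r *\<^sub>R x"] r x by (simp add: scaleR_nonneg_nonneg)
    from scaleR_left_mono[OF this, of r] r have "r *\<^sub>R U x \<le> U (r *\<^sub>R x)" by simp
    with sc_le[OF r x] show ?thesis by simp
  qed
  obtain L where L: "linear L" "\<And>x. 0 \<le> x \<Longrightarrow> L x = U x"
    using linear_extension[of U] add scale by metis
  have S_le: "op_app S x \<le> L x" if "S \<in> \<A>" "0 \<le> x" for S x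
    using up[OF rk_sum.single[OF that]] L(2)[OF that(2)] by simp
  have "positive_operator (\<lambda>x. L x - op_app S0 x)"
    using S_le[OF S0] L(1) by (simp add: positive_operator_def linear_compose_sub linear_op_app)
  then have "regular (\<lambda>x. L x - op_app S0 x)"
    by (rule regularI[OF _ positive_operator_zero]) simp
  from regular_add[OF this regular_op_app[of S0]] have "regular L" by simp
  then have app: "op_app (Abs_regular_operator L) = L" by (simp add: Abs_regular_operator_inverse)
  show ?thesis
  proof (intro exI[of _ "Abs_regular_operator L"] conjI ballI allI impI)
    show "S \<le> Abs_regular_operator L" if "S \<in> \<A>" for S
      using S_le[OF that] by (simp add: regular_operator_le_iff app)
    show "Abs_regular_operator L \<le> R'" if R': "\<forall>S\<in>\<A>. S \<le> R'" for R'
      using L(2) least rk_sum_le[of \<A> R'] R' by (simp add: regular_operator_le_iff app)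
  qed
qed

instantiation regular_operator ::
  (riesz_space, dedekind_complete_riesz_space) dedekind_complete_riesz_space
begin

definition Sup_regular_operator :: "('a, 'b) regular_operator set \<Rightarrow> ('a, 'b) regular_operator" where
  "Sup_regular_operator \<A> = (THE U. (\<forall>S\<in>\<A>. S \<le> U) \<and> (\<forall>R. (\<forall>S\<in>\<A>. S \<le> R) \<longrightarrow> U \<le> R))"

definition Inf_regular_operator :: "('a, 'b) regular_operator set \<Rightarrow> ('a, 'b) regular_operator" where
  "Inf_regular_operator \<A> = - Sup (uminus ` \<A>)"

definition sup_regular_operator ::
  "('a, 'b) regular_operator \<Rightarrow> ('a, 'b) regular_operator \<Rightarrow> ('a, 'b) regular_operator" where
  "sup_regular_operator S T = Sup {S, T}"

definition inf_regular_operator ::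
  "('a, 'b) regular_operator \<Rightarrow> ('a, 'b) regular_operator \<Rightarrow> ('a, 'b) regular_operator" where
  "inf_regular_operator S T = Inf {S, T}"

definition abs_regular_operator :: "('a, 'b) regular_operator \<Rightarrow> ('a, 'b) regular_operator" where
  "abs_regular_operator S = sup S (- S)"

lemma Sup_regular_operator_lub:
  fixes \<A> :: "('a, 'b) regular_operator set"
  assumes "\<A> \<noteq> {}" "\<And>S. S \<in> \<A> \<Longrightarrow> S \<le> R"
  shows "(\<forall>S\<in>\<A>. S \<le> Sup \<A>) \<and> (\<forall>R. (\<forall>S\<in>\<A>. S \<le> R) \<longrightarrow> Sup \<A> \<le> R)"
proof -
  have "\<exists>!U. (\<forall>S\<in>\<A>. S \<le> U) \<and> (\<forall>R. (\<forall>S\<in>\<A>. S \<le> R) \<longrightarrow> U \<le> R)"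
    using regular_operator_ex_lub[OF assms] by (blast intro: order_antisym)
  then show ?thesis unfolding Sup_regular_operator_def by (rule theI')
qed

instance
proof
  fix S T R :: "('a, 'b) regular_operator"
  show up: "S \<le> Sup \<A>" if "S \<in> \<A>" "bdd_above \<A>"
    for S and \<A> :: "('a, 'b) regular_operator set"
    using that Sup_regular_operator_lub[of \<A>] unfolding bdd_above_def by blast
  show least: "Sup \<A> \<le> R" if "\<A> \<noteq> {}" "\<And>S. S \<in> \<A> \<Longrightarrow> S \<le> R"
    for R and \<A> :: "('a, 'b) regular_operator set"
    using that Sup_regular_operator_lub[of \<A> R] by blast
  show low: "Inf \<A> \<le> S" if "S \<in> \<A>" "bdd_below \<A>"
    for S and \<A> :: "('a, 'b) regular_operator set"
  proof -
    from that(2) obtain m where "\<And>S. S \<in> \<A> \<Longrightarrow> m \<le> S" by (auto simp: bdd_below_def)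
    then have "bdd_above (uminus ` \<A>)" by (intro bdd_aboveI[of _ "- m"]) auto
    from up[OF imageI[OF that(1)] this] show ?thesis
      unfolding Inf_regular_operator_def by (simp add: minus_le_iff)
  qed
  show greatest: "R \<le> Inf \<A>" if "\<A> \<noteq> {}" "\<And>S. S \<in> \<A> \<Longrightarrow> R \<le> S"
    for R and \<A> :: "('a, 'b) regular_operator set"
  proof -
    have "Sup (uminus ` \<A>) \<le> - R" using that by (intro least) auto
    then show ?thesis unfolding Inf_regular_operator_def by (simp add: le_minus_iff)
  qed
  have bdd: "bdd_above {S, T}" for S T :: "('a, 'b) regular_operator"
    using regular_operator_pair_bounded[of S T] by (auto simp: bdd_above_def)
  have bdd': "bdd_below {S, T}" for S T :: "('a, 'b) regular_operator"
    using regular_operator_pair_bounded[of "- S" "- T"]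
    by (auto simp: bdd_below_def minus_le_iff)
  show "S \<le> sup S T" "T \<le> sup S T"
    unfolding sup_regular_operator_def by (rule up[OF _ bdd], simp)+
  show "inf S T \<le> S" "inf S T \<le> T"
    unfolding inf_regular_operator_def by (rule low[OF _ bdd'], simp)+
  show "S \<le> R \<Longrightarrow> T \<le> R \<Longrightarrow> sup S T \<le> R"
    unfolding sup_regular_operator_def by (rule least) auto
  show "R \<le> S \<Longrightarrow> R \<le> T \<Longrightarrow> R \<le> inf S T"
    unfolding inf_regular_operator_def by (rule greatest) auto
  show "\<bar>S\<bar> = sup S (- S)" by (rule abs_regular_operator_def)
qed

end


section \<open>Order continuous operators\<close>

definition directed_on :: "'i set \<Rightarrow> ('i \<Rightarrow> 'i \<Rightarrow> bool) \<Rightarrow> bool" where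
  "directed_on I le \<longleftrightarrow> I \<noteq> {} \<and> (\<forall>i\<in>I. le i i) \<and>
    (\<forall>i\<in>I. \<forall>j\<in>I. \<forall>k\<in>I. le i j \<longrightarrow> le j k \<longrightarrow> le i k) \<and>
    (\<forall>i\<in>I. \<forall>j\<in>I. \<exists>k\<in>I. le i k \<and> le j k)"

definition net_decreasing_to_0 ::
  "'i set \<Rightarrow> ('i \<Rightarrow> 'i \<Rightarrow> bool) \<Rightarrow> ('i \<Rightarrow> 'a::riesz_space) \<Rightarrow> bool" where
  "net_decreasing_to_0 I le y \<longleftrightarrow> (\<forall>i\<in>I. \<forall>j\<in>I. le i j \<longrightarrow> y j \<le> y i) \<and>
    (\<forall>i\<in>I. 0 \<le> y i) \<and> (\<forall>b. (\<forall>i\<in>I. b \<le> y i) \<longrightarrow> b \<le> 0)"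

definition net_order_converges_to_0 ::
  "'i set \<Rightarrow> ('i \<Rightarrow> 'i \<Rightarrow> bool) \<Rightarrow> ('i \<Rightarrow> 'a::riesz_space) \<Rightarrow> bool" where
  "net_order_converges_to_0 I le x \<longleftrightarrow>
    (\<exists>y. net_decreasing_to_0 I le y \<and> (\<forall>i\<in>I. \<bar>x i\<bar> \<le> y i))"

text \<open>A definition cannot quantify over all index types of nets. Directed subsets of \<open>'a \<times> 'a\<close>
  already give the full notion, see \<open>order_continuous_net\<close> below.\<close>

definition order_continuous :: "('a::riesz_space \<Rightarrow> 'b::riesz_space) \<Rightarrow> bool" where
  "order_continuous T \<longleftrightarrow>
    (\<forall>(I :: ('a \<times> 'a) set) le x. directed_on I le \<longrightarrow>
      net_order_converges_to_0 I le x \<longrightarrow> net_order_converges_to_0 I le (\<lambda>i. T (x i)))"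

lemma order_continuous_net:
  fixes I :: "'i set" and x :: "'i \<Rightarrow> 'a::riesz_space"
  assumes T: "order_continuous (T :: 'a \<Rightarrow> 'b::riesz_space)"
    and I: "directed_on I le" and x: "net_order_converges_to_0 I le x"
  shows "net_order_converges_to_0 I le (\<lambda>i. T (x i))"
proof -
  from x obtain y where y: "net_decreasing_to_0 I le y" "\<And>i. i \<in> I \<Longrightarrow> \<bar>x i\<bar> \<le> y i"
    unfolding net_order_converges_to_0_def by blast
  define J where "J = {(d, z). d \<in> y ` I \<and> \<bar>z\<bar> \<le> d}"
  define leJ :: "'a \<times> 'a \<Rightarrow> 'a \<times> 'a \<Rightarrow> bool" where "leJ p q \<longleftrightarrow> fst q \<le> fst p" for p q
  have inJ: "(y i, x i) \<in> J" if "i \<in> I" for i using that y by (auto simp: J_def)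
  have "directed_on J leJ"
    unfolding directed_on_def
  proof (intro conjI ballI impI)
    show "J \<noteq> {}" using I inJ unfolding directed_on_def by blast
  next
    fix p q assume "p \<in> J" "q \<in> J"
    then obtain i j where ij: "i \<in> I" "j \<in> I" "fst p = y i" "fst q = y j" by (auto simp: J_def)
    with I obtain k where k: "k \<in> I" "le i k" "le j k" unfolding directed_on_def by blast
    with ij y(1) have "y k \<le> y i" "y k \<le> y j" unfolding net_decreasing_to_0_def by blast+
    with ij inJ[OF k(1)] show "\<exists>r\<in>J. leJ p r \<and> leJ q r"
      by (intro bexI[of _ "(y k, x k)"]) (auto simp: leJ_def)
  qed (auto simp: leJ_def)
  moreover have "net_order_converges_to_0 J leJ snd"
    unfolding net_order_converges_to_0_def
  proof (intro exI[of _ fst] conjI)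
    have "b \<le> 0" if "\<forall>p\<in>J. b \<le> fst p" for b
    proof -
      have "\<forall>i\<in>I. b \<le> y i" using that inJ by fastforce
      with y(1) show ?thesis unfolding net_decreasing_to_0_def by blast
    qed
    then show "net_decreasing_to_0 J leJ fst"
      using y(1) unfolding net_decreasing_to_0_def by (auto simp: leJ_def J_def)
  qed (auto simp: J_def)
  ultimately have "net_order_converges_to_0 J leJ (\<lambda>p. T (snd p))"
    using T unfolding order_continuous_def by blast
  then obtain w where w: "net_decreasing_to_0 J leJ w" "\<And>p. p \<in> J \<Longrightarrow> \<bar>T (snd p)\<bar> \<le> w p"
    unfolding net_order_converges_to_0_def by blast
  have mono: "w q \<le> w p" if "p \<in> J" "q \<in> J" "fst q \<le> fst p" for p q
    using w(1) that unfolding net_decreasing_to_0_def leJ_def by blast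
  have "net_decreasing_to_0 I le (\<lambda>i. w (y i, x i))"
    unfolding net_decreasing_to_0_def
  proof (intro conjI ballI allI impI)
    fix i j assume "i \<in> I" "j \<in> I" "le i j"
    with y(1) show "w (y j, x j) \<le> w (y i, x i)"
      unfolding net_decreasing_to_0_def by (intro mono) (auto intro: inJ)
  next
    fix i assume "i \<in> I"
    with w(1) inJ show "0 \<le> w (y i, x i)" unfolding net_decreasing_to_0_def by blast
  next
    fix b assume b: "\<forall>i\<in>I. b \<le> w (y i, x i)"
    have "b \<le> w p" if p: "p \<in> J" for p
    proof -
      from p obtain i where i: "i \<in> I" "fst p = y i" by (auto simp: J_def)
      have "w (y i, x i) \<le> w p" using i p by (intro mono inJ) auto
      with b i show ?thesis by (meson order_trans)
    qed
    with w(1) show "b \<le> 0" unfolding net_decreasing_to_0_def by blast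
  qed
  moreover have "\<bar>T (x i)\<bar> \<le> w (y i, x i)" if "i \<in> I" for i
    using w(2)[OF inJ[OF that]] by simp
  ultimately show ?thesis unfolding net_order_converges_to_0_def by blast
qed

definition order_continuous_operators ::
  "('a::riesz_space, 'b::riesz_space) regular_operator set" where
  "order_continuous_operators = {T. order_continuous (op_app T)}"


section \<open>Two-sided multiplication operators\<close>

lift_definition op_comp ::
  "('b::riesz_space, 'c::riesz_space) regular_operator \<Rightarrow> ('a::riesz_space, 'b) regular_operator \<Rightarrow>
    ('a, 'c) regular_operator"
  is "\<lambda>S T x. S (T x)" by (rule regular_comp)

lemma op_comp_diff_left: "op_comp (S - T) U = op_comp S U - op_comp T U"
  by (rule op_app_eqI) (simp add: op_comp.rep_eq op_app_simps)

lemma op_comp_diff_right: "op_comp S (T - U) = op_comp S T - op_comp S U"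
  by (rule op_app_eqI) (simp add: op_comp.rep_eq op_app_simps op_app_linear_simps)

lemma op_comp_mono_pos:
  assumes "0 \<le> S" "0 \<le> T" shows "0 \<le> op_comp S T"
  using assms by (simp add: regular_operator_le_iff op_app_simps op_comp.rep_eq)

lemma positive_two_sided_mult:
  fixes A :: "('c::dedekind_complete_riesz_space, 'd::dedekind_complete_riesz_space) regular_operator"
    and B :: "('a::riesz_space, 'b::riesz_space) regular_operator"
  assumes "0 \<le> A" "0 \<le> B"
  shows "positive_operator (\<lambda>T. op_comp A (op_comp T B))"
proof -
  have "linear (\<lambda>T. op_comp A (op_comp T B))"
  proof (rule linearI)
    fix S T :: "('b, 'c) regular_operator" and r :: real
    show "op_comp A (op_comp (S + T) B) = op_comp A (op_comp S B) + op_comp A (op_comp T B)"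
      by (rule op_app_eqI) (simp add: op_comp.rep_eq op_app_simps op_app_linear_simps)
    show "op_comp A (op_comp (r *\<^sub>R T) B) = r *\<^sub>R op_comp A (op_comp T B)"
      by (rule op_app_eqI) (simp add: op_comp.rep_eq op_app_simps op_app_linear_simps)
  qed
  then show ?thesis
    using assms by (simp add: positive_operator_def op_comp_mono_pos)
qed

lift_definition two_sided_mult ::
  "('c::dedekind_complete_riesz_space, 'd::dedekind_complete_riesz_space) regular_operator \<Rightarrow>
    ('a::riesz_space, 'b::riesz_space) regular_operator \<Rightarrow>
    (('b, 'c) regular_operator, ('a, 'd) regular_operator) regular_operator"
  is "\<lambda>A B T. op_comp A (op_comp T B)"
proof -
  fix A :: "('c, 'd) regular_operator" and B :: "('a, 'b) regular_operator"
  obtain A1 A2 where A: "0 \<le> A1" "0 \<le> A2" "A = A1 - A2" by (rule regular_operator_pos_decomp)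
  obtain B1 B2 where B: "0 \<le> B1" "0 \<le> B2" "B = B1 - B2" by (rule regular_operator_pos_decomp)
  show "regular (\<lambda>T. op_comp A (op_comp T B))"
  proof (rule regularI)
    show "positive_operator (\<lambda>T. op_comp A1 (op_comp T B1) + op_comp A2 (op_comp T B2))"
      "positive_operator (\<lambda>T. op_comp A1 (op_comp T B2) + op_comp A2 (op_comp T B1))"
      by (intro positive_operator_add positive_two_sided_mult A B)+
  qed (simp add: A(3) B(3) op_comp_diff_left op_comp_diff_right)
qed

end

theory Submission
  imports Defs
begin

text \<open>
  The absolute value is the supremum of \<open>B\<close> and \<open>- B\<close>, so it suffices to treat suprema. Write
  \<open>M\<close> for the supremum of the multiplication operators with right factors \<open>B\<close> and \<open>D\<close>. As the
  multiplication operator is monotone in its right factor for fixed \<open>A \<ge> 0\<close>, the inequality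
  \<open>(M T) w \<le> A (T ((B \<squnion> D) w))\<close> is immediate for \<open>T \<ge> 0\<close> and \<open>w \<ge> 0\<close>, and everything rests on
  the reverse inequality.

  By the Riesz--Kantorovich formula, \<open>(B \<squnion> D) w\<close> is the supremum of the vectors
  \<open>B y + D (w - y)\<close> with \<open>0 \<le> y \<le> w\<close> (lemma \<open>riesz_kantorovich_sup_le\<close>). For such a vector \<open>s\<close>,
  splitting \<open>w = y + (w - y)\<close> gives \<open>A (R s) \<le> (M R) w\<close> for every positive \<open>R\<close>. These vectors do
  not form a directed set, so order continuity does not apply to them directly. However, the set
  of all \<open>s\<close> with \<open>A (R s) \<le> (M R) w\<close> for every positive \<open>R\<close> is closed under binary suprema: a
  positive \<open>R\<close> can be split as \<open>R = R\<^sub>1 + R\<^sub>2\<close>, both summands positive, in such a way that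
  \<open>R (a \<squnion> b) = R\<^sub>1 a + R\<^sub>2 b\<close> (lemma \<open>split_operator_at_sup\<close>), and \<open>M R = M R\<^sub>1 + M R\<^sub>2\<close>. It is
  essential here that \<open>R\<close> ranges over all positive operators, not only over \<open>T\<close>. Hence
  \<open>(B \<squnion> D) w\<close> is the supremum of an upward directed set of such \<open>s\<close>, and order continuity of \<open>A\<close>
  and \<open>T\<close> carries the inequality over to the limit (lemma \<open>two_sided_mult_sup_pos\<close>).

  A general order continuous \<open>T\<close> is the difference of its positive and negative part, and these
  are again continuous along downward directed sets with infimum \<open>0\<close>
  (lemma \<open>downward_to_0_pos_part\<close>); both sides of the claim are linear in \<open>T\<close>.
\<close>

section \<open>Positive operators given by pointwise suprema\<close>

text \<open>Both the positive part of an operator and the component of a positive operator on a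
  principal ideal are pointwise suprema over families indexed by the positive cone. This lemma
  isolates what makes such a supremum additive and positively homogeneous.\<close>

lemma positive_operator_from_Sup:
  fixes F :: "'a::riesz_space \<Rightarrow> 'b::dedekind_complete_riesz_space set"
  assumes zero: "\<And>x. 0 \<le> x \<Longrightarrow> 0 \<in> F x"
    and bdd: "\<And>x. 0 \<le> x \<Longrightarrow> bdd_above (F x)"
    and super: "\<And>x y v w. \<lbrakk>0 \<le> x; 0 \<le> y; v \<in> F x; w \<in> F y\<rbrakk> \<Longrightarrow> \<exists>u\<in>F (x + y). v + w \<le> u"
    and sub: "\<And>x y u. \<lbrakk>0 \<le> x; 0 \<le> y; u \<in> F (x + y)\<rbrakk> \<Longrightarrow> \<exists>v\<in>F x. \<exists>w\<in>F y. u \<le> v + w"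
    and scale: "\<And>r x v. \<lbrakk>0 < r; 0 \<le> x; v \<in> F x\<rbrakk> \<Longrightarrow> r *\<^sub>R v \<in> F (r *\<^sub>R x)"
  obtains L where "0 \<le> L" "\<And>x. 0 \<le> x \<Longrightarrow> op_app L x = Sup (F x)"
proof -
  define U where "U x = Sup (F x)" for x
  have up: "v \<le> U x" if "0 \<le> x" "v \<in> F x" for x v
    unfolding U_def using that bdd by (intro cSup_upper)
  have least: "U x \<le> u" if "0 \<le> x" "\<And>v. v \<in> F x \<Longrightarrow> v \<le> u" for x u
    unfolding U_def using that zero by (intro cSup_least) auto
  have nonneg: "0 \<le> U x" if "0 \<le> x" for x
    using up zero that by blast
  have add: "U (x + y) = U x + U y" if x: "0 \<le> x" and y: "0 \<le> y" for x y
  proof (rule order_antisym)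
    show "U (x + y) \<le> U x + U y"
    proof (rule least)
      fix u assume "u \<in> F (x + y)"
      with sub x y obtain v w where "v \<in> F x" "w \<in> F y" "u \<le> v + w" by blast
      then show "u \<le> U x + U y" using up x y by (meson add_mono order_trans)
    qed (use x y in simp)
    have "v + w \<le> U (x + y)" if vw: "v \<in> F x" "w \<in> F y" for v w
    proof -
      from super[OF x y vw] obtain u where "u \<in> F (x + y)" "v + w \<le> u" by blast
      with up[of "x + y" u] x y show ?thesis by (meson add_nonneg_nonneg order_trans)
    qed
    then have "U x \<le> U (x + y) - w" if "w \<in> F y" for w
      using that by (intro least x) (simp add: le_diff_eq)
    then have "w \<le> U (x + y) - U x" if "w \<in> F y" for w
      using that by (simp add: le_diff_eq add.commute)
    then have "U y \<le> U (x + y) - U x" by (intro least y)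
    then show "U x + U y \<le> U (x + y)" by (simp add: le_diff_eq add.commute)
  qed
  \<comment> \<open>Homogeneity needs only one inequality; the other one is the same inequality for \<open>1 / r\<close>.\<close>
  have scale_le: "r *\<^sub>R U x \<le> U (r *\<^sub>R x)" if r: "0 < r" and x: "0 \<le> x" for r x
  proof -
    have "v \<le> (1 / r) *\<^sub>R U (r *\<^sub>R x)" if "v \<in> F x" for v
    proof -
      have "r *\<^sub>R v \<le> U (r *\<^sub>R x)"
        using r x that by (intro up scale scaleR_nonneg_nonneg) auto
      then have "(1 / r) *\<^sub>R (r *\<^sub>R v) \<le> (1 / r) *\<^sub>R U (r *\<^sub>R x)"
        using r by (intro scaleR_left_mono) auto
      with r show ?thesis by simp
    qed
    then have "U x \<le> (1 / r) *\<^sub>R U (r *\<^sub>R x)" by (intro least x)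
    then have "r *\<^sub>R U x \<le> r *\<^sub>R ((1 / r) *\<^sub>R U (r *\<^sub>R x))"
      using r by (intro scaleR_left_mono) auto
    with r show ?thesis by simp
  qed
  have scale_eq: "U (r *\<^sub>R x) = r *\<^sub>R U x" if r: "0 \<le> r" and x: "0 \<le> x" for r x
  proof (cases "r = 0")
    case True
    with add[of 0 0] show ?thesis by simp
  next
    case False
    with r have r: "0 < r" by simp
    have "r *\<^sub>R ((1 / r) *\<^sub>R U (r *\<^sub>R x)) \<le> r *\<^sub>R U ((1 / r) *\<^sub>R (r *\<^sub>R x))"
      using r x by (intro scaleR_left_mono scale_le scaleR_nonneg_nonneg) auto
    with r scale_le[OF r x] show ?thesis by (intro order_antisym) auto
  qed
  obtain L where L: "linear L" "\<And>x. 0 \<le> x \<Longrightarrow> L x = U x"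
    using linear_extension[of U] add scale_eq by blast
  then have "positive_operator L" using nonneg by (simp add: positive_operator_def)
  then have "regular L" by (auto intro: regularI[OF _ positive_operator_zero])
  then have app: "op_app (Abs_regular_operator L) = L" by (simp add: Abs_regular_operator_inverse)
  show ?thesis
    using L(2) nonneg
    by (intro that[of "Abs_regular_operator L"])
      (auto simp: regular_operator_le_iff op_app_simps app U_def)
qed

lemma op_app_mono:
  assumes "S \<le> T" "0 \<le> x" shows "op_app S x \<le> op_app T x"
  using assms by (simp add: regular_operator_le_iff)

lemma op_app_mono_pos:
  assumes "0 \<le> T" "x \<le> y" shows "op_app T x \<le> op_app T y"
proof -
  have "0 \<le> op_app T (y - x)"
    using op_app_mono[OF assms(1), of "y - x"] assms(2) by (simp add: op_app_simps)
  then show ?thesis by (simp add: op_app_linear_simps)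
qed

lemma op_app_nonneg:
  assumes "0 \<le> T" "0 \<le> x" shows "0 \<le> op_app T x"
  using op_app_mono_pos[OF assms] by (simp add: op_app_linear_simps)

text \<open>The nontrivial half of the Riesz--Kantorovich formula
  \<open>(S \<squnion> T) x = sup {S y + T (x - y) | 0 \<le> y \<le> x}\<close>. Since \<open>S \<squnion> T = T + (S - T) \<squnion> 0\<close>, it is enough
  to construct an operator \<open>L\<close> with \<open>L x = sup {(S - T) y | 0 \<le> y \<le> x}\<close>, which dominates both \<open>S - T\<close>
  and \<open>0\<close>.\<close>

lemma riesz_kantorovich_sup_le:
  fixes S T :: "('a::riesz_space, 'b::dedekind_complete_riesz_space) regular_operator"
  assumes x: "0 \<le> x"
    and u: "\<And>y. 0 \<le> y \<Longrightarrow> y \<le> x \<Longrightarrow> op_app S y + op_app T (x - y) \<le> u"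
  shows "op_app (sup S T) x \<le> u"
proof -
  define F where "F x = op_app (S - T) ` {0..x}" for x
  have bdd: "bdd_above (F x)" if "0 \<le> x" for x
  proof (rule bdd_aboveI)
    fix v assume "v \<in> F x"
    then obtain y where y: "0 \<le> y" "y \<le> x" "v = op_app (S - T) y" by (auto simp: F_def)
    have "v \<le> op_app (sup (S - T) 0) y" using y by (auto intro: op_app_mono)
    also have "\<dots> \<le> op_app (sup (S - T) 0) x" using y by (auto intro: op_app_mono_pos)
    finally show "v \<le> op_app (sup (S - T) 0) x" .
  qed
  obtain L where L: "0 \<le> L" "\<And>x. 0 \<le> x \<Longrightarrow> op_app L x = Sup (F x)"
  proof (rule positive_operator_from_Sup[of F])
    fix x :: 'a assume x: "0 \<le> x"
    show "0 \<in> F x" using x by (auto simp: F_def op_app_linear_simps intro: image_eqI[of _ _ 0])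
    show "bdd_above (F x)" using x by (rule bdd)
    fix r :: real and v assume r: "0 < r" and "v \<in> F x"
    then obtain y where y: "0 \<le> y" "y \<le> x" "v = op_app (S - T) y" by (auto simp: F_def)
    with r show "r *\<^sub>R v \<in> F (r *\<^sub>R x)" unfolding F_def
      by (intro image_eqI[of _ _ "r *\<^sub>R y"])
        (auto simp: op_app_linear_simps intro: scaleR_left_mono scaleR_nonneg_nonneg)
  next
    fix x y :: 'a and v w assume "0 \<le> x" "0 \<le> y" "v \<in> F x" "w \<in> F y"
    then obtain a b where "0 \<le> a" "a \<le> x" "v = op_app (S - T) a"
      "0 \<le> b" "b \<le> y" "w = op_app (S - T) b" by (auto simp: F_def)
    then show "\<exists>u\<in>F (x + y). v + w \<le> u" unfolding F_def
      by (intro bexI[of _ "v + w"] image_eqI[of _ _ "a + b"])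
        (auto simp: op_app_linear_simps add_mono)
  next
    fix x y :: 'a and u assume xy: "0 \<le> x" "0 \<le> y" and "u \<in> F (x + y)"
    then obtain c where c: "0 \<le> c" "c \<le> x + y" "u = op_app (S - T) c" by (auto simp: F_def)
    then have *: "0 \<le> x + y - c" "c + (x + y - c) = x + y" by simp_all
    obtain p q r s where "0 \<le> p" "0 \<le> q" "0 \<le> r" "0 \<le> s"
      "c = p + q" "x + y - c = r + s" "x = p + r" "y = q + s"
      by (rule riesz_decomposition[OF c(1) *(1) xy *(2)])
    then show "\<exists>v\<in>F x. \<exists>w\<in>F y. u \<le> v + w" unfolding F_def c(3)
      by (intro bexI[of _ "op_app (S - T) p"] bexI[of _ "op_app (S - T) q"] imageI)
        (auto simp: op_app_linear_simps)
  qed blast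
  have "S - T \<le> L"
    using L(2) bdd by (auto simp: regular_operator_le_iff F_def intro: cSup_upper)
  with L(1) have "sup S T \<le> T + L" by (simp add: diff_le_eq add.commute)
  then have "op_app (sup S T) x \<le> op_app T x + op_app L x"
    using op_app_mono[OF _ x] by (fastforce simp: op_app_simps)
  moreover have "op_app L x \<le> u - op_app T x"
  proof -
    have "Sup (F x) \<le> u - op_app T x"
    proof (rule cSup_least)
      show "F x \<noteq> {}" using x by (auto simp: F_def)
      fix v assume "v \<in> F x"
      then obtain y where y: "0 \<le> y" "y \<le> x" "v = op_app (S - T) y" by (auto simp: F_def)
      show "v \<le> u - op_app T x"
        using u[OF y(1,2)] unfolding y(3)
        by (simp add: op_app_simps op_app_linear_simps algebra_simps)
    qed
    with L(2)[OF x] show ?thesis by simp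
  qed
  ultimately show ?thesis by (metis add.commute le_diff_eq order_trans)
qed

section \<open>Splitting a positive operator along a supremum\<close>

lemma scaleR_inf_distrib:
  fixes x y :: "'a::riesz_space"
  assumes r: "0 < r"
  shows "r *\<^sub>R inf x y = inf (r *\<^sub>R x) (r *\<^sub>R y)"
proof (rule order_antisym)
  show "r *\<^sub>R inf x y \<le> inf (r *\<^sub>R x) (r *\<^sub>R y)"
    using r by (intro inf_greatest scaleR_left_mono) auto
  have "(1 / r) *\<^sub>R inf (r *\<^sub>R x) (r *\<^sub>R y) \<le> (1 / r) *\<^sub>R (r *\<^sub>R x)"
    "(1 / r) *\<^sub>R inf (r *\<^sub>R x) (r *\<^sub>R y) \<le> (1 / r) *\<^sub>R (r *\<^sub>R y)"
    using r by (intro scaleR_left_mono; simp)+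
  with r have "(1 / r) *\<^sub>R inf (r *\<^sub>R x) (r *\<^sub>R y) \<le> inf x y" by (intro inf_greatest) auto
  then have "r *\<^sub>R ((1 / r) *\<^sub>R inf (r *\<^sub>R x) (r *\<^sub>R y)) \<le> r *\<^sub>R inf x y"
    using r by (intro scaleR_left_mono) auto
  with r show "inf (r *\<^sub>R x) (r *\<^sub>R y) \<le> r *\<^sub>R inf x y" by simp
qed

lemma inf_add_le:
  fixes x y z :: "'a::riesz_space"
  assumes "0 \<le> x" "0 \<le> y" "0 \<le> z"
  shows "inf (x + y) z \<le> inf x z + inf y z"
proof -
  have "inf x z + inf y z = inf (inf (x + y) (z + y)) (inf (x + z) (z + z))"
    by (simp add: add_inf_distrib_left add_inf_distrib_right)
  moreover have "inf (x + y) z \<le> \<dots>"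
    using assms by (auto intro!: inf_greatest intro: le_infI1 le_infI2 add_increasing add_increasing2)
  ultimately show ?thesis by simp
qed

lemma inf_scaleR_eq_0:
  fixes u v :: "'a::riesz_space"
  assumes u: "0 \<le> u" and v: "0 \<le> v" and "inf u v = 0" and t: "0 \<le> t"
  shows "inf v (t *\<^sub>R u) = 0"
proof (rule order_antisym)
  let ?r = "max 1 t"
  have "1 *\<^sub>R v \<le> ?r *\<^sub>R v" "t *\<^sub>R u \<le> ?r *\<^sub>R u" using u v by (intro scaleR_right_mono; simp)+
  then have "inf v (t *\<^sub>R u) \<le> inf (?r *\<^sub>R v) (?r *\<^sub>R u)" by (intro inf_mono) simp_all
  also have "\<dots> = ?r *\<^sub>R inf v u" by (rule scaleR_inf_distrib[symmetric]) simp
  finally show "inf v (t *\<^sub>R u) \<le> 0" using assms(3) by (simp add: inf.commute)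
  show "0 \<le> inf v (t *\<^sub>R u)" using u v t by (simp add: scaleR_nonneg_nonneg)
qed

text \<open>Put \<open>u = (a - b)\<^sup>+\<close> and \<open>v = (b - a)\<^sup>+\<close>, which are disjoint. The operator
  \<open>T\<^sub>1 x = sup {T (x \<sqinter> t u) | t \<ge> 0}\<close> agrees with \<open>T\<close> on the ideal generated by \<open>u\<close>
  and vanishes on everything disjoint from \<open>u\<close>, in particular at \<open>v\<close>. So \<open>T\<^sub>1\<close> does not distinguish \<open>a \<squnion> b\<close> from
  \<open>a = a \<squnion> b - v\<close>, and \<open>T - T\<^sub>1\<close> does not distinguish it from \<open>b = a \<squnion> b - u\<close>. Taking the supremum
  after applying \<open>T\<close> places it in the Dedekind complete range.\<close>

lemma split_operator_at_sup:
  fixes T :: "('a::riesz_space, 'b::dedekind_complete_riesz_space) regular_operator"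
  assumes T: "0 \<le> T"
  obtains T1 T2 where "0 \<le> T1" "0 \<le> T2" "T = T1 + T2"
    "op_app T (sup a b) = op_app T1 a + op_app T2 b"
proof -
  define u v where "u = sup a b - b" and "v = sup a b - a"
  have u: "0 \<le> u" and v: "0 \<le> v" by (simp_all only: u_def v_def diff_ge_0_iff_ge sup_ge1 sup_ge2)
  have "inf u v = 0"
    using diff_sup_eq_inf[of "sup a b" b a] add_inf_distrib_left[of "sup a b" "- b" "- a"]
    by (simp add: u_def v_def sup.commute)
  define F where "F x = (\<lambda>t. op_app T (inf x (t *\<^sub>R u))) ` {0..}" for x
  have bound: "w \<le> op_app T x" if "w \<in> F x" for x w
    using that T by (auto simp: F_def intro: op_app_mono_pos)
  obtain L where L: "0 \<le> L" "\<And>x. 0 \<le> x \<Longrightarrow> op_app L x = Sup (F x)"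
  proof (rule positive_operator_from_Sup[of F])
    fix x :: 'a assume x: "0 \<le> x"
    show "0 \<in> F x" using x
      by (auto simp: F_def op_app_linear_simps inf_absorb2 intro!: image_eqI[of _ _ 0])
    show "bdd_above (F x)" using bound by (rule bdd_aboveI)
    fix r :: real and w assume r: "0 < r" and "w \<in> F x"
    then obtain t where t: "0 \<le> t" "w = op_app T (inf x (t *\<^sub>R u))" by (auto simp: F_def)
    with r show "r *\<^sub>R w \<in> F (r *\<^sub>R x)" unfolding F_def
      by (intro image_eqI[of _ _ "r * t"])
        (simp_all add: op_app_linear_simps(5)[symmetric] scaleR_inf_distrib)
  next
    fix x y :: 'a and w z assume xy: "0 \<le> x" "0 \<le> y" and "w \<in> F x" "z \<in> F y"
    then obtain s t where st: "0 \<le> s" "w = op_app T (inf x (s *\<^sub>R u))"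
      "0 \<le> t" "z = op_app T (inf y (t *\<^sub>R u))" by (auto simp: F_def)
    have "inf x (s *\<^sub>R u) + inf y (t *\<^sub>R u) \<le> inf (x + y) ((s + t) *\<^sub>R u)"
      by (auto simp: scaleR_add_left intro!: inf_greatest add_mono)
    then have "w + z \<le> op_app T (inf (x + y) ((s + t) *\<^sub>R u))"
      using op_app_mono_pos[OF T] by (fastforce simp: st op_app_linear_simps)
    with st show "\<exists>u\<in>F (x + y). w + z \<le> u" unfolding F_def by (meson imageI add_nonneg_nonneg atLeast_iff)
  next
    fix x y :: 'a and w assume xy: "0 \<le> x" "0 \<le> y" and "w \<in> F (x + y)"
    then obtain t where t: "0 \<le> t" "w = op_app T (inf (x + y) (t *\<^sub>R u))" by (auto simp: F_def)
    have "inf (x + y) (t *\<^sub>R u) \<le> inf x (t *\<^sub>R u) + inf y (t *\<^sub>R u)"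
      using xy t(1) u by (intro inf_add_le scaleR_nonneg_nonneg)
    then have "w \<le> op_app T (inf x (t *\<^sub>R u)) + op_app T (inf y (t *\<^sub>R u))"
      using op_app_mono_pos[OF T] by (fastforce simp: t op_app_linear_simps)
    with t show "\<exists>v\<in>F x. \<exists>z\<in>F y. w \<le> v + z" unfolding F_def by (meson imageI atLeast_iff)
  qed blast
  have "L \<le> T"
    using L(2) bound unfolding regular_operator_le_iff
    by (auto intro!: cSup_least simp: F_def)
  have Lv: "op_app L v = 0"
  proof -
    have "F v = {0}"
      using inf_scaleR_eq_0[OF u v \<open>inf u v = 0\<close>]
      by (auto simp: F_def op_app_linear_simps image_iff intro!: exI[of _ 0])
    with L(2)[OF v] show ?thesis by simp
  qed
  have Lu: "op_app L u = op_app T u"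
  proof (rule order_antisym)
    show "op_app L u \<le> op_app T u" by (rule op_app_mono[OF \<open>L \<le> T\<close> u])
    have "op_app T u \<in> F u" by (auto simp: F_def intro!: image_eqI[of _ _ 1])
    then show "op_app T u \<le> op_app L u"
      unfolding L(2)[OF u] by (intro cSup_upper bdd_aboveI[OF bound])
  qed
  show ?thesis
  proof
    show "0 \<le> L" "0 \<le> T - L" "T = L + (T - L)" using L(1) \<open>L \<le> T\<close> by simp_all
    show "op_app T (sup a b) = op_app L a + op_app (T - L) b"
      using Lu Lv by (simp add: u_def v_def op_app_simps op_app_linear_simps algebra_simps)
  qed
qed

section \<open>Order continuity along downward directed sets\<close>

definition downward_to_0 :: "'a::riesz_space set \<Rightarrow> bool" where
  "downward_to_0 D \<longleftrightarrow> D \<noteq> {} \<and> (\<forall>x\<in>D. \<forall>y\<in>D. \<exists>z\<in>D. z \<le> x \<and> z \<le> y) \<and>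
    (\<forall>x\<in>D. 0 \<le> x) \<and> (\<forall>b. (\<forall>x\<in>D. b \<le> x) \<longrightarrow> b \<le> 0)"

lemma downward_to_0_tail:
  assumes D: "downward_to_0 D" and x: "x \<in> D"
  shows "downward_to_0 {d\<in>D. d \<le> x}"
proof -
  have "b \<le> 0" if b: "\<forall>d\<in>{d\<in>D. d \<le> x}. b \<le> d" for b
  proof -
    have "b \<le> d" if d: "d \<in> D" for d
    proof -
      from D d x obtain z where "z \<in> D" "z \<le> d" "z \<le> x" unfolding downward_to_0_def by blast
      with b show ?thesis using order_trans by blast
    qed
    with D show ?thesis unfolding downward_to_0_def by blast
  qed
  moreover have "\<exists>z\<in>{d\<in>D. d \<le> x}. z \<le> a \<and> z \<le> c" if "a \<in> D" "c \<in> D" "a \<le> x" for a c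
    using D that unfolding downward_to_0_def by (smt (verit) mem_Collect_eq order_trans)
  ultimately show ?thesis
    using D x unfolding downward_to_0_def
    by (intro conjI ballI allI impI) (blast, blast, blast, meson)
qed

text \<open>The set \<open>D\<close>, ordered by \<open>\<ge>\<close>, serves as its own index set, and \<open>inf y d\<close> decreases to \<open>0\<close>
  along it.\<close>

lemma order_continuous_lower_bound:
  fixes T :: "'a::riesz_space \<Rightarrow> 'b::riesz_space"
  assumes T: "order_continuous T" and D: "downward_to_0 D" and y: "0 \<le> y"
    and b: "\<And>d. d \<in> D \<Longrightarrow> b \<le> T (inf y d)"
  shows "b \<le> 0"
proof -
  let ?le = "\<lambda>d e. e \<le> (d :: 'a)"
  have "directed_on D ?le"
    using D unfolding directed_on_def downward_to_0_def by auto
  moreover have "net_order_converges_to_0 D ?le (inf y)"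
    unfolding net_order_converges_to_0_def
  proof (intro exI[of _ "inf y"] conjI ballI)
    show "net_decreasing_to_0 D ?le (inf y)"
      using D y unfolding net_decreasing_to_0_def downward_to_0_def
      by (auto intro: le_infI2)
    show "\<bar>inf y d\<bar> \<le> inf y d" if "d \<in> D" for d
      using D y that unfolding downward_to_0_def by simp
  qed
  ultimately have "net_order_converges_to_0 D ?le (\<lambda>d. T (inf y d))"
    by (rule order_continuous_net[OF T])
  then obtain w where w: "net_decreasing_to_0 D ?le w" "\<And>d. d \<in> D \<Longrightarrow> \<bar>T (inf y d)\<bar> \<le> w d"
    unfolding net_order_converges_to_0_def by blast
  have "b \<le> w d" if "d \<in> D" for d
    using b[OF that] w(2)[OF that] abs_ge_self[of "T (inf y d)"] by (meson order_trans)
  with w(1) show ?thesis unfolding net_decreasing_to_0_def by blast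
qed

text \<open>Let \<open>z\<close> be a lower bound of the image and fix \<open>x \<in> D\<close>. For \<open>0 \<le> y \<le> x\<close> and \<open>d \<le> x\<close> in \<open>D\<close> we
  have \<open>y - inf y d \<le> x - d\<close>, hence \<open>T y - T (inf y d) \<le> T\<^sup>+ x - T\<^sup>+ d \<le> T\<^sup>+ x - z\<close>. As
  \<open>T (inf y d)\<close> tends to \<open>0\<close>, this leaves \<open>T y \<le> T\<^sup>+ x - z\<close>, and the supremum over \<open>y\<close> is
  \<open>T\<^sup>+ x \<le> T\<^sup>+ x - z\<close>, that is, \<open>z \<le> 0\<close>.\<close>

lemma downward_to_0_pos_part:
  fixes T :: "('a::riesz_space, 'b::dedekind_complete_riesz_space) regular_operator"
  assumes T: "order_continuous (op_app T)" and D: "downward_to_0 D"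
  shows "downward_to_0 (op_app (sup T 0) ` D)"
proof -
  let ?P = "sup T 0"
  have P: "0 \<le> ?P" by simp
  have "z \<le> 0" if z: "\<forall>d\<in>D. z \<le> op_app ?P d" for z
  proof -
    from D obtain x where x: "x \<in> D" "0 \<le> x" unfolding downward_to_0_def by blast
    have "op_app T y + op_app 0 (x - y) \<le> op_app ?P x - z" if y: "0 \<le> y" "y \<le> x" for y
    proof -
      have "z + op_app T y - op_app ?P x \<le> 0"
      proof (rule order_continuous_lower_bound[OF T downward_to_0_tail[OF D x(1)] y(1)])
        fix d assume "d \<in> {d\<in>D. d \<le> x}"
        then have d: "d \<in> D" "d \<le> x" by simp_all
        have "y + d \<le> inf y d + x"
        proof -
          have "y + d = inf y d + sup y d"
            using add_eq_inf_sup[of y d] by (simp only: add.commute)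
          also have "\<dots> \<le> inf y d + x" using y d by (intro add_left_mono) simp
          finally show ?thesis .
        qed
        have "p - i \<le> q - e" if "p + e \<le> i + q" for p q i e :: 'a
          using that by (simp add: algebra_simps)
        from this[OF \<open>y + d \<le> inf y d + x\<close>] have *: "y - inf y d \<le> x - d" .
        have "op_app T (y - inf y d) \<le> op_app ?P (y - inf y d)"
          by (rule op_app_mono) (simp_all only: sup_ge1 diff_ge_0_iff_ge inf_le1)
        also have "\<dots> \<le> op_app ?P (x - d)" by (rule op_app_mono_pos[OF P *])
        also have "\<dots> \<le> op_app ?P x - z" using z d by (simp add: op_app_linear_simps)
        finally have "op_app T y - op_app T (inf y d) \<le> op_app ?P x - z"
          by (simp only: linear_diff[OF linear_op_app])
        moreover have "z + p - q \<le> i" if "p - i \<le> q - z" for p q i :: 'b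
          using that by (simp add: algebra_simps)
        ultimately show "z + op_app T y - op_app ?P x \<le> op_app T (inf y d)" by blast
      qed
      then show ?thesis by (simp add: op_app_simps algebra_simps)
    qed
    then have "op_app ?P x \<le> op_app ?P x - z" by (rule riesz_kantorovich_sup_le[OF x(2)])
    then show ?thesis by simp
  qed
  moreover have "\<exists>c\<in>D. op_app ?P c \<le> op_app ?P a \<and> op_app ?P c \<le> op_app ?P b"
    if "a \<in> D" "b \<in> D" for a b
    using D that op_app_mono_pos[OF P] unfolding downward_to_0_def by meson
  ultimately show ?thesis
    using D op_app_nonneg[OF P] unfolding downward_to_0_def by auto
qed

section \<open>Suprema of two-sided multiplication operators\<close>

lemma op_app_two_sided_mult:
  "op_app (op_app (two_sided_mult A B) T) x = op_app A (op_app T (op_app B x))"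
  by (simp add: two_sided_mult.rep_eq op_comp.rep_eq)

lemma two_sided_mult_mono:
  assumes "0 \<le> A" "B \<le> C"
  shows "two_sided_mult A B \<le> two_sided_mult A C"
  using assms
  by (auto simp: regular_operator_le_iff[of "two_sided_mult A B"]
      regular_operator_le_iff[of "op_app (two_sided_mult A B) T" for T]
      op_app_two_sided_mult intro!: op_app_mono_pos op_app_mono)

text \<open>The assumption \<open>cont\<close> is the only consequence of order continuity that the argument uses: the
  composition of \<open>A\<close> and \<open>T\<close> is continuous along downward directed sets.\<close>

lemma two_sided_mult_sup_pos:
  fixes A :: "('y::dedekind_complete_riesz_space, 'z::dedekind_complete_riesz_space) regular_operator"
    and T :: "('x::dedekind_complete_riesz_space, 'y) regular_operator"
    and B D :: "('w::riesz_space, 'x) regular_operator"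
  assumes A: "0 \<le> A" and T: "0 \<le> T"
    and cont: "\<And>E. downward_to_0 E \<Longrightarrow> downward_to_0 (op_app A ` op_app T ` E)"
  shows "op_app (sup (two_sided_mult A B) (two_sided_mult A D)) T =
    op_app (two_sided_mult A (sup B D)) T"
proof (rule order_antisym)
  let ?M = "sup (two_sided_mult A B) (two_sided_mult A D)" and ?C = "sup B D"
  have "?M \<le> two_sided_mult A ?C"
    using A by (intro sup_least two_sided_mult_mono) auto
  then show "op_app ?M T \<le> op_app (two_sided_mult A ?C) T" by (rule op_app_mono[OF _ T])
  have "op_app A (op_app T (op_app ?C w)) \<le> op_app (op_app ?M T) w" if w: "0 \<le> w" for w
  proof -
    \<comment> \<open>Quantifying over all positive \<open>R\<close> makes \<open>G\<close> closed under suprema, because the proof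
      for \<open>R\<close> uses the bounds for the two parts of \<open>R\<close>.\<close>
    define G where "G = {s. s \<le> op_app ?C w \<and>
      (\<forall>R\<ge>0. op_app A (op_app R s) \<le> op_app (op_app ?M R) w)}"
    have G_sup: "sup a b \<in> G" if "a \<in> G" "b \<in> G" for a b
    proof -
      have "op_app A (op_app R (sup a b)) \<le> op_app (op_app ?M R) w" if "0 \<le> R" for R
      proof -
        obtain R1 R2 where R: "0 \<le> R1" "0 \<le> R2" "R = R1 + R2"
          "op_app R (sup a b) = op_app R1 a + op_app R2 b"
          using split_operator_at_sup[OF \<open>0 \<le> R\<close>] by blast
        have "op_app A (op_app R1 a) + op_app A (op_app R2 b)
            \<le> op_app (op_app ?M R1) w + op_app (op_app ?M R2) w"
          using \<open>a \<in> G\<close> \<open>b \<in> G\<close> R(1,2) by (intro add_mono) (auto simp: G_def)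
        then show ?thesis unfolding R(4) by (simp add: R(3) op_app_linear_simps op_app_simps)
      qed
      with that show ?thesis by (simp add: G_def)
    qed
    have G_single: "op_app B y + op_app D (w - y) \<in> G" if y: "0 \<le> y" "y \<le> w" for y
    proof -
      have "op_app B y + op_app D (w - y) \<le> op_app ?C y + op_app ?C (w - y)"
        using y by (intro add_mono op_app_mono) auto
      moreover have "op_app A (op_app R (op_app B y + op_app D (w - y))) \<le> op_app (op_app ?M R) w"
        if R: "0 \<le> R" for R
      proof -
        have *: "op_app (two_sided_mult A B) R \<le> op_app ?M R"
          "op_app (two_sided_mult A D) R \<le> op_app ?M R"
          using R by (intro op_app_mono; simp)+
        then have "op_app (op_app (two_sided_mult A B) R) y
            + op_app (op_app (two_sided_mult A D) R) (w - y)
            \<le> op_app (op_app ?M R) y + op_app (op_app ?M R) (w - y)"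
          using y by (intro add_mono op_app_mono[OF *(1)] op_app_mono[OF *(2)]) auto
        then show ?thesis by (simp add: op_app_two_sided_mult op_app_linear_simps)
      qed
      ultimately show ?thesis by (simp add: G_def op_app_linear_simps)
    qed
    \<comment> \<open>In other words, \<open>G\<close> is upward directed with supremum \<open>?C w\<close>.\<close>
    have "downward_to_0 ((-) (op_app ?C w) ` G)"
      unfolding downward_to_0_def
    proof (intro conjI ballI allI impI)
      show "(-) (op_app ?C w) ` G \<noteq> {}" using G_single[of 0] w by auto
    next
      fix p q assume "p \<in> (-) (op_app ?C w) ` G" "q \<in> (-) (op_app ?C w) ` G"
      then obtain a b where "a \<in> G" "b \<in> G" "p = op_app ?C w - a" "q = op_app ?C w - b" by blast
      then show "\<exists>z\<in>(-) (op_app ?C w) ` G. z \<le> p \<and> z \<le> q"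
        using G_sup[of a b] by (intro bexI[of _ "op_app ?C w - sup a b"]) (auto simp only: diff_left_mono sup_ge1 sup_ge2)
    next
      fix p assume "p \<in> (-) (op_app ?C w) ` G"
      then show "0 \<le> p" by (auto simp: G_def)
    next
      fix b assume b: "\<forall>p\<in>(-) (op_app ?C w) ` G. b \<le> p"
      have "op_app ?C w \<le> op_app ?C w - b"
      proof (rule riesz_kantorovich_sup_le[OF w])
        fix y :: 'w assume "0 \<le> y" "y \<le> w"
        with b G_single have "b \<le> op_app ?C w - (op_app B y + op_app D (w - y))" by blast
        then show "op_app B y + op_app D (w - y) \<le> op_app ?C w - b"
          by (metis add.commute le_diff_eq)
      qed
      then show "b \<le> 0" by simp
    qed
    then have "downward_to_0 (op_app A ` op_app T ` (-) (op_app ?C w) ` G)" by (rule cont)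
    moreover have "op_app A (op_app T (op_app ?C w)) - op_app (op_app ?M T) w
        \<le> op_app A (op_app T (op_app ?C w - s))" if "s \<in> G" for s
      using that T by (simp add: G_def op_app_linear_simps)
    ultimately have "op_app A (op_app T (op_app ?C w)) - op_app (op_app ?M T) w \<le> 0"
      unfolding downward_to_0_def by blast
    then show ?thesis by simp
  qed
  then show "op_app (two_sided_mult A ?C) T \<le> op_app ?M T"
    by (simp add: regular_operator_le_iff op_app_two_sided_mult)
qed

lemma order_continuous_uminus:
  assumes "order_continuous (op_app T)"
  shows "order_continuous (op_app (- T))"
  using assms unfolding order_continuous_def net_order_converges_to_0_def
  by (simp add: op_app_simps)

lemma two_sided_mult_sup:
  fixes A :: "('y::dedekind_complete_riesz_space, 'z::dedekind_complete_riesz_space) regular_operator"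
    and T :: "('x::dedekind_complete_riesz_space, 'y) regular_operator"
    and B D :: "('w::riesz_space, 'x) regular_operator"
  assumes A: "0 \<le> A" "order_continuous (op_app A)" and T: "order_continuous (op_app T)"
  shows "op_app (sup (two_sided_mult A B) (two_sided_mult A D)) T =
    op_app (two_sided_mult A (sup B D)) T"
proof -
  have pos: "op_app (sup (two_sided_mult A B) (two_sided_mult A D)) (sup S 0) =
    op_app (two_sided_mult A (sup B D)) (sup S 0)"
    if "order_continuous (op_app S)" for S :: "('x, 'y) regular_operator"
  proof (rule two_sided_mult_sup_pos[OF A(1)])
    \<comment> \<open>The positive operator \<open>A\<close> is its own positive part, so the same lemma covers it.\<close>
    fix E :: "'x set" assume "downward_to_0 E"
    then have "downward_to_0 (op_app (sup A 0) ` op_app (sup S 0) ` E)"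
      by (intro downward_to_0_pos_part A(2) that)
    with A(1) show "downward_to_0 (op_app A ` op_app (sup S 0) ` E)" by (simp add: sup_absorb1)
  qed simp
  show ?thesis
    using pos[OF T] pos[OF order_continuous_uminus[OF T]] riesz_minus_eq_pos_parts[of T]
    by (metis op_app_linear_simps(3))
qed

lemma two_sided_mult_uminus: "two_sided_mult A (- B) = - two_sided_mult A B"
  by (rule op_app_eqI, rule op_app_eqI)
    (simp add: op_app_two_sided_mult op_app_simps op_app_linear_simps)

theorem proposition2p2:
  fixes A0 :: "('y::dedekind_complete_riesz_space, 'z::dedekind_complete_riesz_space) regular_operator"
  assumes "0 \<le> A0" and "A0 \<in> order_continuous_operators"
  shows "\<forall>(B :: ('w::riesz_space, 'x::dedekind_complete_riesz_space) regular_operator) D.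
    \<forall>T\<in>(order_continuous_operators :: ('x, 'y) regular_operator set).
      op_app \<bar>two_sided_mult A0 B\<bar> T = op_app (two_sided_mult A0 \<bar>B\<bar>) T \<and>
      op_app (sup (two_sided_mult A0 B) (two_sided_mult A0 D)) T =
        op_app (two_sided_mult A0 (sup B D)) T"
proof (intro allI ballI conjI)
  fix B D :: "('w, 'x) regular_operator" and T :: "('x, 'y) regular_operator"
  assume "T \<in> order_continuous_operators"
  with assms have *: "op_app (sup (two_sided_mult A0 B) (two_sided_mult A0 D)) T =
      op_app (two_sided_mult A0 (sup B D)) T" for B D :: "('w, 'x) regular_operator"
    by (intro two_sided_mult_sup) (simp_all add: order_continuous_operators_def)
  then show "op_app (sup (two_sided_mult A0 B) (two_sided_mult A0 D)) T =
      op_app (two_sided_mult A0 (sup B D)) T" .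
  show "op_app \<bar>two_sided_mult A0 B\<bar> T = op_app (two_sided_mult A0 \<bar>B\<bar>) T"
    using *[of B "- B"] by (simp add: two_sided_mult_uminus abs_regular_operator_def)
qed

end
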